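(* Fix integers $k \geq 2$ and $c \geq 1$. Consider the reoptimization problem whose input is a triple $(G_O, G_N, OPT(G_O))$, where $G_O=(V_O,E_O)$ is a graph, $G_N$ is obtained from $G_O$ by inserting a graph $G_A=(V_A,E_A)$ with $|V_A| = c$ (via some set of attachment edges $E^a \subseteq V_O \times V_A$), and $OPT(G_O)$ is a minimum-cardinality $k$-path vertex cover of $G_O$. This problem admits a PTAS: for every fixed $\epsilon > 0$ there is an algorithm, running in time polynomial in $n = |V(G_N)|$, that outputs a $k$-path vertex cover $S$ of $G_N$ with $|S| \leq (1+\epsilon)\,|OPT(G_N)|$, where $OPT(G_N)$ is a minimum-cardinality $k$-path vertex cover of $G_N$. (Concretely, the algorithm takes the smaller of $OPT(G_O)\cup V_A$ and a smallest $k$-path vertex cover of $G_N$ among all vertex subsets of size at most $\lceil c/\epsilon\rceil$.)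
   Context: All graphs are finite, simple and undirected. A $k$-path is a simple path containing exactly $k$ vertices. A set $S \subseteq V(G)$ is a $k$-path vertex cover of $G$ if every $k$-path in $G$ contains at least one vertex of $S$. Given disjoint graphs $G=(V,E)$ and $G_A=(V_A,E_A)$ and a set of attachment edges $E^a \subseteq V \times V_A$, inserting $G_A$ into $G$ yields the graph $(V \cup V_A, E \cup E_A \cup E^a)$. *)

theory Defs
  imports Complex_Main "HOL-Computational_Algebra.Polynomial"
begin

section \<open>Finite simple graphs, k-paths and k-path vertex covers\<close>

type_synonym 'v graph = "'v set \<times> 'v set set"

abbreviation verts :: "'v graph \<Rightarrow> 'v set" where "verts G \<equiv> fst G"
abbreviation edges :: "'v graph \<Rightarrow> 'v set set" where "edges G \<equiv> snd G"

definition simple_graph :: "'v graph \<Rightarrow> bool" where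
  "simple_graph G \<longleftrightarrow>
     finite (verts G) \<and> (\<forall>e\<in>edges G. e \<subseteq> verts G \<and> card e = 2)"

definition k_path :: "nat \<Rightarrow> 'v graph \<Rightarrow> 'v list \<Rightarrow> bool" where
  "k_path k G p \<longleftrightarrow>
     length p = k \<and> distinct p \<and> set p \<subseteq> verts G \<and>
     (\<forall>i. Suc i < k \<longrightarrow> {p ! i, p ! Suc i} \<in> edges G)"

definition k_path_vertex_cover :: "nat \<Rightarrow> 'v graph \<Rightarrow> 'v set \<Rightarrow> bool" where
  "k_path_vertex_cover k G S \<longleftrightarrow>
     S \<subseteq> verts G \<and> (\<forall>p. k_path k G p \<longrightarrow> set p \<inter> S \<noteq> {})"

definition min_k_path_vertex_cover :: "nat \<Rightarrow> 'v graph \<Rightarrow> 'v set \<Rightarrow> bool" where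
  "min_k_path_vertex_cover k G S \<longleftrightarrow>
     k_path_vertex_cover k G S \<and>
     (\<forall>T. k_path_vertex_cover k G T \<longrightarrow> card S \<le> card T)"

definition insert_graph :: "'v graph \<Rightarrow> 'v graph \<Rightarrow> ('v \<times> 'v) set \<Rightarrow> 'v graph" where
  "insert_graph G A Ea =
     (verts G \<union> verts A, edges G \<union> edges A \<union> {{u, v} | u v. (u, v) \<in> Ea})"

section \<open>Machine model\<close>

text \<open>
  Algorithms are programs of a structured random access machine whose memory consists of
  named, unbounded, 0-indexed arrays of natural numbers; a scalar variable is cell 0 of an
  array. A program mentions only finitely many array names. The only arithmetic operations are
  addition and truncated subtraction; in particular there is no multiplication, so that the
  bit length of the stored numbers grows by at most a constant per executed command, and time
  under the unit-cost measure is polynomially related to Turing machine time. Every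
  evaluated expression node and every executed command is charged one time unit.
\<close>

type_synonym store = "string \<Rightarrow> nat \<Rightarrow> nat"

datatype aexp = Const nat | Cell string aexp | Plus aexp aexp | Minus aexp aexp

fun aval :: "aexp \<Rightarrow> store \<Rightarrow> nat" where
  "aval (Const m) s = m"
| "aval (Cell x a) s = s x (aval a s)"
| "aval (Plus a b) s = aval a s + aval b s"
| "aval (Minus a b) s = aval a s - aval b s"

fun acost :: "aexp \<Rightarrow> nat" where
  "acost (Const m) = 1"
| "acost (Cell x a) = 1 + acost a"
| "acost (Plus a b) = 1 + acost a + acost b"
| "acost (Minus a b) = 1 + acost a + acost b"

text \<open>
  \<open>Assign x i a\<close> stores the value of \<open>a\<close> in cell \<open>i\<close> of array \<open>x\<close>. Guards are true iff
  their value is nonzero.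
\<close>

datatype com =
    Skip
  | Assign string aexp aexp
  | Seq com com
  | If aexp com com
  | While aexp com

text \<open>\<open>exec C s t s'\<close>: started in \<open>s\<close>, program \<open>C\<close> halts in \<open>s'\<close> after \<open>t\<close> time units.\<close>

inductive exec :: "com \<Rightarrow> store \<Rightarrow> nat \<Rightarrow> store \<Rightarrow> bool" where
  Skip: "exec Skip s 1 s"
| Assign: "exec (Assign x i a) s (1 + acost i + acost a) (s(x := (s x)(aval i s := aval a s)))"
| Seq: "\<lbrakk>exec C s t s'; exec D s' t' s''\<rbrakk> \<Longrightarrow> exec (Seq C D) s (1 + t + t') s''"
| IfTrue: "\<lbrakk>aval b s \<noteq> 0; exec C s t s'\<rbrakk> \<Longrightarrow> exec (If b C D) s (1 + acost b + t) s'"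
| IfFalse: "\<lbrakk>aval b s = 0; exec D s t s'\<rbrakk> \<Longrightarrow> exec (If b C D) s (1 + acost b + t) s'"
| WhileFalse: "aval b s = 0 \<Longrightarrow> exec (While b C) s (1 + acost b) s"
| WhileTrue: "\<lbrakk>aval b s \<noteq> 0; exec C s t s'; exec (While b C) s' t' s''\<rbrakk>
    \<Longrightarrow> exec (While b C) s (1 + acost b + t + t') s''"

inductive_cases exec_SkipE: "exec Skip s t s'"
inductive_cases exec_AssignE: "exec (Assign x i a) s t s'"
inductive_cases exec_SeqE: "exec (Seq C D) s t s'"
inductive_cases exec_IfE: "exec (If b C D) s t s'"
inductive_cases exec_WhileE: "exec (While b C) s t s'"

lemma exec_deterministic:
  "exec C s t s' \<Longrightarrow> exec C s u r \<Longrightarrow> u = t \<and> r = s'"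
proof (induction arbitrary: u r rule: exec.induct)
  case Skip
  then show ?case by (rule exec_SkipE) simp
next
  case Assign
  then show ?case by (rule exec_AssignE) simp
next
  case Seq
  from Seq.prems show ?case by (rule exec_SeqE) (fastforce dest: Seq.IH)
next
  case IfTrue
  from IfTrue.prems show ?case by (rule exec_IfE) (use IfTrue.hyps(1) in \<open>auto dest: IfTrue.IH\<close>)
next
  case IfFalse
  from IfFalse.prems show ?case by (rule exec_IfE) (use IfFalse.hyps(1) in \<open>auto dest: IfFalse.IH\<close>)
next
  case WhileFalse
  from WhileFalse.prems show ?case by (rule exec_WhileE) (use WhileFalse.hyps in simp_all)
next
  case WhileTrue
  from WhileTrue.prems show ?case by (rule exec_WhileE) (use WhileTrue.hyps(1) in \<open>fastforce dest: WhileTrue.IH\<close>)+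
qed

section \<open>Representation of inputs and outputs\<close>

text \<open>
  A list \<open>vs\<close> enumerating the vertices of the new graph assigns them the numbers \<open>0..<n\<close>.
  Vertex sets are given by characteristic vectors, edge sets by adjacency matrices in
  row-major order. All remaining cells are initially 0.
\<close>

definition vertex_vector :: "'v list \<Rightarrow> 'v set \<Rightarrow> nat \<Rightarrow> nat" where
  "vertex_vector vs A i = (if i < length vs \<and> vs ! i \<in> A then 1 else 0)"

definition adjacency_matrix :: "'v list \<Rightarrow> 'v set set \<Rightarrow> nat \<Rightarrow> nat" where
  "adjacency_matrix vs E i =
     (let n = length vs
      in if i < n * n \<and> {vs ! (i div n), vs ! (i mod n)} \<in> E then 1 else 0)"

definition encode_input :: "'v list \<Rightarrow> 'v graph \<Rightarrow> 'v graph \<Rightarrow> 'v set \<Rightarrow> store" where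
  "encode_input vs G_O G_N OPT =
     (\<lambda>_ _. 0)
       (''n'' := (\<lambda>_. 0)(0 := length vs),
        ''VO'' := vertex_vector vs (verts G_O),
        ''EO'' := adjacency_matrix vs (edges G_O),
        ''EN'' := adjacency_matrix vs (edges G_N),
        ''OPT'' := vertex_vector vs OPT)"

definition decode_output :: "'v list \<Rightarrow> store \<Rightarrow> 'v set" where
  "decode_output vs s = {vs ! i | i. i < length vs \<and> s ''S'' i \<noteq> 0}"

section \<open>Reoptimization\<close>

text \<open>
  \<open>OPT\<close> is the given optimum of the old graph. The enumeration \<open>vs\<close> is part of the
  representation of the input and may be arbitrary.
\<close>

definition reopt_instance ::
  "nat \<Rightarrow> nat \<Rightarrow> 'v graph \<Rightarrow> 'v graph \<Rightarrow> ('v \<times> 'v) set \<Rightarrow> 'v set \<Rightarrow> 'v list \<Rightarrow> bool" where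
  "reopt_instance k c G_O G_A Ea OPT vs \<longleftrightarrow>
     simple_graph G_O \<and> simple_graph G_A \<and> verts G_O \<inter> verts G_A = {} \<and>
     card (verts G_A) = c \<and> Ea \<subseteq> verts G_O \<times> verts G_A \<and>
     min_k_path_vertex_cover k G_O OPT \<and>
     distinct vs \<and> set vs = verts (insert_graph G_O G_A Ea)"

text \<open>
  \<open>S\<close> is the smaller of \<open>B\<close> and a smallest cover with at most \<open>m\<close> vertices; it is \<open>B\<close> if there
  is no such cover. Ties may be broken arbitrarily.
\<close>

definition smaller_candidate :: "nat \<Rightarrow> 'v graph \<Rightarrow> int \<Rightarrow> 'v set \<Rightarrow> 'v set \<Rightarrow> bool" where
  "smaller_candidate k G m B S \<longleftrightarrow>
     (S = B \<or> k_path_vertex_cover k G S \<and> int (card S) \<le> m) \<and>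
     card S \<le> card B \<and>
     (\<forall>T. k_path_vertex_cover k G T \<and> int (card T) \<le> m \<longrightarrow> card S \<le> card T)"

end

theory Submission
  imports Defs
begin

text \<open>
  Let \<open>m = \<lceil>c/\<epsilon>\<rceil>\<close>. If the optimum of the new graph has at most \<open>m\<close> vertices, then the exhaustive
  search finds a cover of that size. Otherwise \<open>c\<close> is at most \<open>\<epsilon>\<close> times the optimum, and adding
  \<open>V\<^sub>A\<close> to the old optimum costs at most \<open>c\<close>, since the new optimum restricted to the old graph
  is a cover there.

  The search tries all vertex tuples of length \<open>r = 0, \<dots>, m\<close> by \<open>r\<close> nested loops, and tests
  each by \<open>k\<close> further nested loops over all candidate paths. Using tuples of every length \<open>r\<close> and
  recording \<open>r\<close> as the size of a solution makes it unnecessary to count distinct entries: a cover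
  with \<open>r\<close> vertices is found at length \<open>r\<close> at the latest. All loops count to \<open>n\<close>, and their number
  depends only on \<open>k\<close> and \<open>m\<close>, so the time is polynomial.
\<close>

section \<open>Timed Hoare triples\<close>

text \<open>Time bound for programs in which every loop performs at most \<open>n\<close> iterations.\<close>

fun loop_poly :: "com \<Rightarrow> nat poly" where
  "loop_poly Skip = [:1:]"
| "loop_poly (Assign x i a) = [:1 + acost i + acost a:]"
| "loop_poly (Seq C D) = [:1:] + loop_poly C + loop_poly D"
| "loop_poly (If b C D) = [:1 + acost b:] + loop_poly C + loop_poly D"
| "loop_poly (While b C) = [:1, 1:] * ([:1 + acost b:] + loop_poly C)"

text \<open>Total correctness. The time bound is no parameter but is read off the program text, so
  the rules need not carry bounds along and the final polynomial depends on the program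
  alone.\<close>

definition triple :: "nat \<Rightarrow> (store \<Rightarrow> bool) \<Rightarrow> com \<Rightarrow> (store \<Rightarrow> bool) \<Rightarrow> bool" where
  "triple n P C Q \<longleftrightarrow>
     (\<forall>s. P s \<longrightarrow> (\<exists>t s'. exec C s t s' \<and> t \<le> poly (loop_poly C) n \<and> Q s'))"

lemma tripleI:
  "(\<And>s. P s \<Longrightarrow> \<exists>t s'. exec C s t s' \<and> t \<le> poly (loop_poly C) n \<and> Q s') \<Longrightarrow> triple n P C Q"
  by (simp add: triple_def)

lemma tripleE:
  assumes "triple n P C Q" "P s"
  obtains t s' where "exec C s t s'" "t \<le> poly (loop_poly C) n" "Q s'"
  using assms unfolding triple_def by blast

lemma triple_conseq:
  assumes "triple n P C Q" "\<And>s. P' s \<Longrightarrow> P s" "\<And>s. Q s \<Longrightarrow> Q' s"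
  shows "triple n P' C Q'"
  using assms unfolding triple_def by blast

lemma triple_Skip:
  assumes "\<And>s. P s \<Longrightarrow> Q s"
  shows "triple n P Skip Q"
proof (rule tripleI)
  fix s assume "P s"
  then show "\<exists>t s'. exec Skip s t s' \<and> t \<le> poly (loop_poly Skip) n \<and> Q s'"
    using exec.Skip[of s] assms by fastforce
qed

lemma triple_Assign:
  assumes "\<And>s. P s \<Longrightarrow> Q (s(x := (s x)(aval i s := aval a s)))"
  shows "triple n P (Assign x i a) Q"
proof (rule tripleI)
  fix s assume "P s"
  then show "\<exists>t s'. exec (Assign x i a) s t s' \<and> t \<le> poly (loop_poly (Assign x i a)) n \<and> Q s'"
    using exec.Assign[of x i a s] assms by fastforce
qed

lemma triple_Seq:
  assumes "triple n P C R" "triple n R D Q"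
  shows "triple n P (Seq C D) Q"
proof (rule tripleI)
  fix s assume "P s"
  with assms(1) obtain t s' where C: "exec C s t s'" "t \<le> poly (loop_poly C) n" "R s'"
    unfolding triple_def by blast
  from assms(2) C(3) obtain t' s'' where D: "exec D s' t' s''" "t' \<le> poly (loop_poly D) n" "Q s''"
    unfolding triple_def by blast
  from exec.Seq[OF C(1) D(1)] C(2) D(2,3)
  show "\<exists>t s'. exec (Seq C D) s t s' \<and> t \<le> poly (loop_poly (Seq C D)) n \<and> Q s'"
    by (intro exI conjI) auto
qed

lemma triple_If:
  assumes "triple n (\<lambda>s. P s \<and> aval b s \<noteq> 0) C Q" "triple n (\<lambda>s. P s \<and> aval b s = 0) D Q"
  shows "triple n P (If b C D) Q"
proof (rule tripleI)
  fix s assume "P s"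
  show "\<exists>t s'. exec (If b C D) s t s' \<and> t \<le> poly (loop_poly (If b C D)) n \<and> Q s'"
  proof (cases "aval b s = 0")
    case True
    with assms(2) \<open>P s\<close> obtain t s' where "exec D s t s'" "t \<le> poly (loop_poly D) n" "Q s'"
      by (auto elim: tripleE)
    with exec.IfFalse[OF True this(1)] show ?thesis by (intro exI conjI) auto
  next
    case False
    with assms(1) \<open>P s\<close> obtain t s' where "exec C s t s'" "t \<le> poly (loop_poly C) n" "Q s'"
      by (auto elim: tripleE)
    with exec.IfTrue[OF False this(1)] show ?thesis by (intro exI conjI) auto
  qed
qed

lemma triple_While:
  assumes step: "\<And>j. j < n \<Longrightarrow> triple n (Inv j) C (Inv (Suc j))"
    and guard: "\<And>j s. j \<le> n \<Longrightarrow> Inv j s \<Longrightarrow> aval b s \<noteq> 0 \<longleftrightarrow> j < n"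
  shows "triple n (Inv 0) (While b C) (Inv n)"
proof (rule tripleI)
  let ?T = "poly (loop_poly C) n"
  \<comment> \<open>Each of the \<open>n - j\<close> remaining rounds pays for one guard and one
    body; the \<open>+ 1\<close> covers the final evaluation of the guard.\<close>
  have *: "\<exists>t s'. exec (While b C) s t s' \<and> t \<le> (n - j + 1) * (1 + acost b + ?T) \<and> Inv n s'"
    if "j \<le> n" "Inv j s" for j s
    using that
  proof (induction j arbitrary: s rule: inc_induct)
    case base
    then have "aval b s = 0" using guard[of n s] by simp
    from exec.WhileFalse[OF this] base show ?case by (intro exI conjI) auto
  next
    case (step j)
    from assms(1)[OF \<open>j < n\<close>] step.prems
    obtain t s' where C: "exec C s t s'" "t \<le> ?T" "Inv (Suc j) s'"
      unfolding triple_def by blast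
    from step.IH[OF C(3)] obtain t' s'' where
      W: "exec (While b C) s' t' s''" "t' \<le> (n - Suc j + 1) * (1 + acost b + ?T)" "Inv n s''"
      by blast
    have "aval b s \<noteq> 0" using guard[of j s] step.prems \<open>j < n\<close> by simp
    from exec.WhileTrue[OF this C(1) W(1)]
    have "exec (While b C) s (1 + acost b + t + t') s''" .
    moreover have "n - j + 1 = Suc (n - Suc j + 1)" using \<open>j < n\<close> by simp
    then have "1 + acost b + t + t' \<le> (n - j + 1) * (1 + acost b + ?T)"
      using C(2) W(2) by simp
    ultimately show ?case using W(3) by blast
  qed
  fix s assume "Inv 0 s"
  from *[OF _ this] show
    "\<exists>t s'. exec (While b C) s t s' \<and> t \<le> poly (loop_poly (While b C)) n \<and> Inv n s'"
    by (simp add: algebra_simps)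
qed

section \<open>Counting loops\<close>

text \<open>The counter is an array cell, so that nested loops over one array leave the current
  tuple in it. Truncated subtraction makes the guard nonzero exactly while the counter is below the
  value of \<open>n\<close>.\<close>

definition For :: "string \<Rightarrow> nat \<Rightarrow> com \<Rightarrow> com" where
  "For x d C = Seq (Assign x (Const d) (Const 0))
     (While (Minus (Cell ''n'' (Const 0)) (Cell x (Const d)))
        (Seq C (Assign x (Const d) (Plus (Cell x (Const d)) (Const 1)))))"

text \<open>The loop itself overwrites the counter cell, so the invariant has to be insensitive to
  it; the body may read the counter but must hand it back unchanged.\<close>

lemma triple_For:
  assumes body: "\<And>j. j < n \<Longrightarrow>
      triple n (\<lambda>s. Inv j s \<and> s x d = j) C (\<lambda>s. Inv (Suc j) s \<and> s x d = j)"
    and upd: "\<And>j s v. Inv j s \<Longrightarrow> Inv j (s(x := (s x)(d := v)))"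
    and n: "\<And>j s. Inv j s \<Longrightarrow> s ''n'' 0 = n"
  shows "triple n (Inv 0) (For x d C) (Inv n)"
  unfolding For_def
proof (rule triple_Seq)
  show "triple n (Inv 0) (Assign x (Const d) (Const 0)) (\<lambda>s. Inv 0 s \<and> s x d = 0)"
    by (rule triple_Assign) (simp add: upd)
  have "triple n (\<lambda>s. Inv 0 s \<and> s x d = 0)
     (While (Minus (Cell ''n'' (Const 0)) (Cell x (Const d)))
        (Seq C (Assign x (Const d) (Plus (Cell x (Const d)) (Const 1)))))
     (\<lambda>s. Inv n s \<and> s x d = n)"
  proof (rule triple_While)
    fix j assume "j < n"
    show "triple n (\<lambda>s. Inv j s \<and> s x d = j)
      (Seq C (Assign x (Const d) (Plus (Cell x (Const d)) (Const 1))))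
      (\<lambda>s. Inv (Suc j) s \<and> s x d = Suc j)"
      by (rule triple_Seq[OF body[OF \<open>j < n\<close>]], rule triple_Assign) (simp add: upd)
  qed (auto simp: n)
  then show "triple n (\<lambda>s. Inv 0 s \<and> s x d = 0)
     (While (Minus (Cell ''n'' (Const 0)) (Cell x (Const d)))
        (Seq C (Assign x (Const d) (Plus (Cell x (Const d)) (Const 1)))))
     (Inv n)"
    by (rule triple_conseq) auto
qed

text \<open>The innermost loop counts in cell 0, the outermost in cell \<open>d - 1\<close>. For
  \<open>d = 0\<close> the body runs once, on the empty tuple.\<close>

fun nest :: "string \<Rightarrow> nat \<Rightarrow> com \<Rightarrow> com" where
  "nest x 0 C = C"
| "nest x (Suc d) C = For x d (nest x d C)"

definition tuples :: "nat \<Rightarrow> nat \<Rightarrow> nat list set" where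
  "tuples n d = {p. length p = d \<and> set p \<subseteq> {..<n}}"

text \<open>The invariant is indexed by the set of tuples that have been processed so far.\<close>

lemma triple_nest:
  assumes body: "\<And>D p. p \<in> tuples n d \<Longrightarrow>
      triple n (\<lambda>s. Inv D s \<and> map (s x) [0..<d] = p) C
        (\<lambda>s. Inv (insert p D) s \<and> map (s x) [0..<d] = p)"
    and upd: "\<And>D s i v. Inv D s \<Longrightarrow> Inv D (s(x := (s x)(i := v)))"
    and n: "\<And>D s. Inv D s \<Longrightarrow> s ''n'' 0 = n"
  shows "triple n (Inv D) (nest x d C) (Inv (D \<union> tuples n d))"
proof -
  \<comment> \<open>Generalisation for the induction: the outer counters are frozen at
    \<open>q\<close>, and the \<open>e\<close> inner loops run through all tuples with suffix
    \<open>q\<close>.\<close>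
  have "triple n (\<lambda>s. Inv D s \<and> map (s x) [e..<d] = q) (nest x e C)
      (\<lambda>s. Inv (D \<union> (\<lambda>p. p @ q) ` tuples n e) s \<and> map (s x) [e..<d] = q)"
    if "e \<le> d" "q \<in> tuples n (d - e)" for e q D
    using that
  proof (induction e arbitrary: q D)
    case 0
    moreover have "tuples n 0 = {[]}" by (auto simp: tuples_def)
    ultimately show ?case using body[of q D] by simp
  next
    case (Suc e)
    \<comment> \<open>After \<open>j\<close> rounds of the loop on cell \<open>e\<close>, the
      finished tuples are those whose entry at \<open>e\<close> is below \<open>j\<close> and is
      followed by \<open>q\<close>.\<close>
    define Inv' where "Inv' j s \<longleftrightarrow>
      Inv (D \<union> (\<lambda>p. p @ q) ` {p @ [i] | p i. p \<in> tuples n e \<and> i < j}) s \<and>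
      map (s x) [Suc e..<d] = q" for j s
    have "triple n (Inv' 0) (For x e (nest x e C)) (Inv' n)"
    proof (rule triple_For)
      fix j assume "j < n"
      have q: "j # q \<in> tuples n (d - e)"
        using Suc.prems \<open>j < n\<close> by (auto simp: tuples_def)
      have upt: "[e..<d] = e # [Suc e..<d]" using Suc.prems by (simp add: upt_conv_Cons)
      have un: "D \<union> (\<lambda>p. p @ q) ` {p @ [i] | p i. p \<in> tuples n e \<and> i < j}
             \<union> (\<lambda>p. p @ j # q) ` tuples n e
          = D \<union> (\<lambda>p. p @ q) ` {p @ [i] | p i. p \<in> tuples n e \<and> i < Suc j}"
        by (force simp: less_Suc_eq image_iff)
      show "triple n (\<lambda>s. Inv' j s \<and> s x e = j) (nest x e C) (\<lambda>s. Inv' (Suc j) s \<and> s x e = j)"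
        by (rule triple_conseq[OF Suc.IH[OF _ q,
              of "D \<union> (\<lambda>p. p @ q) ` {p @ [i] | p i. p \<in> tuples n e \<and> i < j}"]])
          (use Suc.prems in \<open>auto simp: Inv'_def upt un\<close>)
    next
      show "Inv' j (s(x := (s x)(e := v)))" if "Inv' j s" for j s v
        using that upd by (auto simp: Inv'_def intro!: map_cong)
    qed (auto simp: Inv'_def n)
    moreover have "{p @ [i] | p i. p \<in> tuples n e \<and> i < n} = tuples n (Suc e)"
    proof (intro equalityI subsetI)
      fix p assume "p \<in> tuples n (Suc e)"
      then show "p \<in> {p @ [i] | p i. p \<in> tuples n e \<and> i < n}"
        by (cases p rule: rev_cases) (auto simp: tuples_def)
    qed (auto simp: tuples_def)
    ultimately show ?case by (simp add: Inv'_def[abs_def])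
  qed
  from this[of d "[]" D] show ?thesis by (simp add: tuples_def)
qed

section \<open>The program\<close>

text \<open>At least one of the truncated differences is zero, so their sum is the distance between
  the two values.\<close>

definition eq_exp :: "aexp \<Rightarrow> aexp \<Rightarrow> aexp" where
  "eq_exp a b = Minus (Const 1) (Plus (Minus a b) (Minus b a))"

lemma aval_eq_exp: "aval (eq_exp a b) s = (if aval a s = aval b s then 1 else 0)"
  by (simp add: eq_exp_def)

text \<open>Serves as a disjunction: natural numbers add up to zero only if all of them are
  zero.\<close>

definition sum_exp :: "aexp list \<Rightarrow> aexp" where
  "sum_exp es = foldr Plus es (Const 0)"

lemma aval_sum_exp_eq_0: "aval (sum_exp es) s = 0 \<longleftrightarrow> (\<forall>e\<in>set es. aval e s = 0)"
  by (induction es) (auto simp: sum_exp_def)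

definition mem_exp :: "nat \<Rightarrow> aexp \<Rightarrow> aexp" where
  "mem_exp r a = sum_exp (map (\<lambda>j. eq_exp (Cell ''I'' (Const j)) a) [0..<r])"

lemma aval_mem_exp: "aval (mem_exp r a) s = 0 \<longleftrightarrow> aval a s \<notin> set (map (s ''I'') [0..<r])"
  by (auto simp: mem_exp_def aval_sum_exp_eq_0 aval_eq_exp image_iff split: if_splits)

text \<open>
  Zero iff the vertices stored in \<open>P\<close> form a \<open>k\<close>-path that avoids the vertices stored in \<open>I\<close>.
  The array \<open>R\<close> holds the multiples of \<open>n\<close>, as the machine cannot multiply.
\<close>

definition defect_exp :: "nat \<Rightarrow> nat \<Rightarrow> aexp" where
  "defect_exp k r = sum_exp
     (concat (map (\<lambda>i. map (\<lambda>j. eq_exp (Cell ''P'' (Const j)) (Cell ''P'' (Const i))) [0..<i]) [0..<k]) @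
      map (\<lambda>i. Minus (Const 1)
        (Cell ''EN'' (Plus (Cell ''R'' (Cell ''P'' (Const i))) (Cell ''P'' (Const (Suc i)))))) [0..<k - 1] @
      map (\<lambda>i. mem_exp r (Cell ''P'' (Const i))) [0..<k])"

text \<open>\<open>bad\<close> counts the tuples in \<open>P\<close> that are \<open>k\<close>-paths
  avoiding the vertices in \<open>I\<close>; it stays zero exactly if those vertices form a
  cover.\<close>

definition check_com :: "nat \<Rightarrow> nat \<Rightarrow> com" where
  "check_com k r = Seq (Assign ''bad'' (Const 0) (Const 0))
     (nest ''P'' k (Assign ''bad'' (Const 0)
        (Plus (Cell ''bad'' (Const 0)) (Minus (Const 1) (defect_exp k r)))))"

definition store_com :: "nat \<Rightarrow> com" where
  "store_com r = Seq
     (For ''J'' 0 (Assign ''S'' (Cell ''J'' (Const 0)) (mem_exp r (Cell ''J'' (Const 0)))))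
     (Assign ''size'' (Const 0) (Const r))"

text \<open>The inner guard is nonzero exactly if \<open>r < size\<close>, so a solution is replaced
  only when the recorded size strictly drops.\<close>

definition step_com :: "nat \<Rightarrow> nat \<Rightarrow> com" where
  "step_com k r = Seq (check_com k r)
     (If (Cell ''bad'' (Const 0)) Skip
        (If (Minus (Cell ''size'' (Const 0)) (Const r)) (store_com r) Skip))"

text \<open>The number of nested loops is part of the program text, so the tuple lengths are
  unrolled instead of being counted by the machine.\<close>

fun search_com :: "nat \<Rightarrow> nat \<Rightarrow> com" where
  "search_com k 0 = nest ''I'' 0 (step_com k 0)"
| "search_com k (Suc m) = Seq (search_com k m) (nest ''I'' (Suc m) (step_com k (Suc m)))"

text \<open>Inserted vertices are recognised as those outside \<open>VO\<close>. The same pass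
  tabulates the multiples of \<open>n\<close> by repeated addition, starting from the initial 0 in
  cell 0 of \<open>R\<close>.\<close>

definition init_com :: com where
  "init_com = For ''J'' 0
     (Seq (Assign ''S'' (Cell ''J'' (Const 0))
             (Plus (Cell ''OPT'' (Cell ''J'' (Const 0)))
                (Minus (Const 1) (Cell ''VO'' (Cell ''J'' (Const 0))))))
     (Seq (Assign ''size'' (Const 0)
             (Plus (Cell ''size'' (Const 0)) (Cell ''S'' (Cell ''J'' (Const 0)))))
          (Assign ''R'' (Plus (Cell ''J'' (Const 0)) (Const 1))
             (Plus (Cell ''R'' (Cell ''J'' (Const 0))) (Cell ''n'' (Const 0))))))"

section \<open>Correctness of the search\<close>

lemma distinct_conv_nth_less: "distinct p \<longleftrightarrow> (\<forall>i<length p. \<forall>j<i. p ! j \<noteq> p ! i)"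
  unfolding distinct_conv_nth by (metis nat_neq_iff order.strict_trans)

locale enumerated_graph =
  fixes k :: nat and G :: "'v graph" and vs :: "'v list"
  assumes distinct_vs: "distinct vs" and set_vs: "set vs = verts G"
begin

abbreviation n :: nat where "n \<equiv> length vs"

abbreviation decode :: "nat set \<Rightarrow> 'v set" where "decode X \<equiv> (!) vs ` X"

section \<open>Vertices, paths and covers in terms of indices\<close>

lemma inj_on_nth_vs: "inj_on ((!) vs) {..<n}"
  using distinct_vs by (simp add: inj_on_def nth_eq_iff_index_eq)

lemma verts_conv: "verts G = decode {..<n}"
  unfolding set_vs[symmetric] by (auto simp: in_set_conv_nth)

lemma decode_Collect:
  assumes "B \<subseteq> verts G"
  shows "decode {i. i < n \<and> vs ! i \<in> B} = B"
  using assms unfolding verts_conv by auto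

text \<open>The part of memory that the search only reads.\<close>

definition ready :: "store \<Rightarrow> bool" where
  "ready s \<longleftrightarrow> s ''n'' 0 = n \<and> s ''EN'' = adjacency_matrix vs (edges G) \<and>
     (\<forall>i<n. s ''R'' i = i * n)"

definition avoiding_path :: "nat set \<Rightarrow> nat list \<Rightarrow> bool" where
  "avoiding_path X p \<longleftrightarrow> k_path k G (map ((!) vs) p) \<and> set p \<inter> X = {}"

lemma k_path_map_nth:
  assumes "p \<in> tuples n k"
  shows "k_path k G (map ((!) vs) p) \<longleftrightarrow>
    distinct p \<and> (\<forall>i. Suc i < k \<longrightarrow> adjacency_matrix vs (edges G) (p ! i * n + p ! Suc i) \<noteq> 0)"
proof -
  have len: "length p = k" and p: "set p \<subseteq> {..<n}" using assms by (auto simp: tuples_def)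
  have "inj_on ((!) vs) (set p)" using inj_on_nth_vs p by (rule inj_on_subset)
  then have "distinct (map ((!) vs) p) \<longleftrightarrow> distinct p" by (simp add: distinct_map)
  moreover have "set (map ((!) vs) p) \<subseteq> verts G" using p by (auto simp flip: set_vs)
  moreover have "adjacency_matrix vs (edges G) (p ! i * n + p ! Suc i) \<noteq> 0 \<longleftrightarrow>
      {vs ! (p ! i), vs ! (p ! Suc i)} \<in> edges G" if "Suc i < k" for i
  proof -
    have lt: "p ! i < n" "p ! Suc i < n" using that p len nth_mem[of _ p] by force+
    \<comment> \<open>The column index is below \<open>n\<close>, so the row-major position lies
      inside the matrix, and division by \<open>n\<close> recovers row and column.\<close>
    have "p ! i * n + p ! Suc i < Suc (p ! i) * n" using lt by simp
    also have "\<dots> \<le> n * n" using lt by (intro mult_right_mono) auto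
    finally have "p ! i * n + p ! Suc i < n * n" .
    moreover have "(p ! i * n + p ! Suc i) div n = p ! i" using lt by (subst div_mult_self3) auto
    ultimately show ?thesis using lt by (simp add: adjacency_matrix_def Let_def)
  qed
  ultimately show ?thesis using len by (auto simp: k_path_def)
qed

lemma aval_defect_exp:
  assumes "ready s" "p \<in> tuples n k" "map (s ''P'') [0..<k] = p"
  shows "aval (defect_exp k r) s = 0 \<longleftrightarrow> avoiding_path (set (map (s ''I'') [0..<r])) p"
proof -
  have p: "p ! i = s ''P'' i" "s ''P'' i < n" if "i < k" for i
    using assms(2,3) that by (auto simp: tuples_def image_subset_iff)
  have R: "s ''R'' (s ''P'' i) = s ''P'' i * n" if "i < k" for i
    using p[OF that] assms(1) by (simp add: ready_def)
  have "aval (defect_exp k r) s = 0 \<longleftrightarrow>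
      (\<forall>i<k. \<forall>j<i. s ''P'' j \<noteq> s ''P'' i) \<and>
      (\<forall>i. Suc i < k \<longrightarrow> s ''EN'' (s ''R'' (s ''P'' i) + s ''P'' (Suc i)) \<noteq> 0) \<and>
      (\<forall>i<k. s ''P'' i \<notin> set (map (s ''I'') [0..<r]))"
    unfolding defect_exp_def aval_sum_exp_eq_0
    by (auto simp: ball_Un aval_mem_exp aval_eq_exp less_diff_conv Suc_le_eq)
  also have "(\<forall>i<k. \<forall>j<i. s ''P'' j \<noteq> s ''P'' i) \<longleftrightarrow> distinct p"
    using assms(2) p by (auto simp: distinct_conv_nth_less tuples_def)
  also have "(\<forall>i. Suc i < k \<longrightarrow> s ''EN'' (s ''R'' (s ''P'' i) + s ''P'' (Suc i)) \<noteq> 0) \<longleftrightarrow>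
      (\<forall>i. Suc i < k \<longrightarrow> adjacency_matrix vs (edges G) (p ! i * n + p ! Suc i) \<noteq> 0)"
    using assms(1) p R by (simp add: ready_def)
  also have "(\<forall>i<k. s ''P'' i \<notin> set (map (s ''I'') [0..<r])) \<longleftrightarrow>
      set p \<inter> set (map (s ''I'') [0..<r]) = {}"
    unfolding assms(3)[symmetric] set_map[of "s ''P''"] by fastforce
  finally show ?thesis
    by (simp add: avoiding_path_def k_path_map_nth[OF assms(2)])
qed

text \<open>Trying all index tuples is exhaustive because every path is the image of such a tuple;
  injectivity of the enumeration carries disjointness over to indices.\<close>

lemma cover_decode_iff:
  assumes "X \<subseteq> {..<n}"
  shows "k_path_vertex_cover k G (decode X) \<longleftrightarrow> \<not> (\<exists>p\<in>tuples n k. avoiding_path X p)"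
proof -
  have sub: "decode X \<subseteq> verts G" using assms by (auto simp flip: set_vs)
  have disj: "set (map ((!) vs) p) \<inter> decode X = {} \<longleftrightarrow> set p \<inter> X = {}" if "p \<in> tuples n k" for p
  proof -
    from inj_on_image_Int[OF inj_on_nth_vs, of "set p" X] that assms show ?thesis
      by (auto simp: tuples_def)
  qed
  have lift: "\<exists>p\<in>tuples n k. q = map ((!) vs) p" if q: "k_path k G q" for q
  proof -
    have "set q \<subseteq> (!) vs ` {..<n}"
      using q by (simp add: k_path_def verts_conv)
    then have "q \<in> lists ((!) vs ` {..<n})" by auto
    then obtain p where "p \<in> lists {..<n}" "q = map ((!) vs) p" by (auto simp: lists_image)
    then show ?thesis using q by (auto simp: tuples_def k_path_def)
  qed
  have "(\<forall>q. k_path k G q \<longrightarrow> set q \<inter> decode X \<noteq> {}) \<longleftrightarrow>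
      (\<forall>p\<in>tuples n k. k_path k G (map ((!) vs) p) \<longrightarrow> set (map ((!) vs) p) \<inter> decode X \<noteq> {})"
    using lift by blast
  also have "\<dots> \<longleftrightarrow> \<not> (\<exists>p\<in>tuples n k. avoiding_path X p)"
    using disj unfolding avoiding_path_def by blast
  finally show ?thesis using sub by (simp add: k_path_vertex_cover_def)
qed

section \<open>Specifications of the program components\<close>

lemma triple_check:
  "triple n (\<lambda>s. ready s \<and> s = s0) (check_com k r)
     (\<lambda>s. (ready s \<and> s ''I'' = s0 ''I'' \<and> s ''S'' = s0 ''S'' \<and> s ''size'' = s0 ''size'') \<and>
        (s ''bad'' 0 \<noteq> 0 \<longleftrightarrow> (\<exists>p\<in>tuples n k. avoiding_path (set (map (s0 ''I'') [0..<r])) p)))"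
proof -
  \<comment> \<open>\<open>s0\<close> names the store before the check, so that the invariant can
    state that \<open>I\<close>, \<open>S\<close> and \<open>size\<close> keep their values.\<close>
  define Inv where "Inv D s \<longleftrightarrow>
     (ready s \<and> s ''I'' = s0 ''I'' \<and> s ''S'' = s0 ''S'' \<and> s ''size'' = s0 ''size'') \<and>
     (s ''bad'' 0 \<noteq> 0 \<longleftrightarrow> (\<exists>p\<in>D. avoiding_path (set (map (s0 ''I'') [0..<r])) p))" for D s
  have init: "triple n (\<lambda>s. ready s \<and> s = s0) (Assign ''bad'' (Const 0) (Const 0)) (Inv {})"
    by (rule triple_Assign) (simp add: Inv_def ready_def)
  have loop: "triple n (Inv {}) (nest ''P'' k (Assign ''bad'' (Const 0)
        (Plus (Cell ''bad'' (Const 0)) (Minus (Const 1) (defect_exp k r))))) (Inv ({} \<union> tuples n k))"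
  proof (rule triple_nest)
    fix D p assume p: "p \<in> tuples n k"
    show "triple n (\<lambda>s. Inv D s \<and> map (s ''P'') [0..<k] = p)
      (Assign ''bad'' (Const 0) (Plus (Cell ''bad'' (Const 0)) (Minus (Const 1) (defect_exp k r))))
      (\<lambda>s. Inv (insert p D) s \<and> map (s ''P'') [0..<k] = p)"
    proof (rule triple_Assign)
      fix s assume s: "Inv D s \<and> map (s ''P'') [0..<k] = p"
      then have I: "s ''I'' = s0 ''I''" and "ready s" by (auto simp: Inv_def)
      from aval_defect_exp[OF this(2) p, of r] s
      have "aval (defect_exp k r) s = 0 \<longleftrightarrow> avoiding_path (set (map (s0 ''I'') [0..<r])) p"
        unfolding I by simp
      then have "s ''bad'' 0 + (1 - aval (defect_exp k r) s) \<noteq> 0 \<longleftrightarrow>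
          s ''bad'' 0 \<noteq> 0 \<or> avoiding_path (set (map (s0 ''I'') [0..<r])) p"
        by linarith
      also have "\<dots> \<longleftrightarrow> (\<exists>q\<in>insert p D. avoiding_path (set (map (s0 ''I'') [0..<r])) q)"
        using s by (simp add: Inv_def disj_commute)
      finally show "Inv (insert p D) (s(''bad'' := (s ''bad'')
          (aval (Const 0) s := aval (Plus (Cell ''bad'' (Const 0)) (Minus (Const 1) (defect_exp k r))) s)))
        \<and> map ((s(''bad'' := (s ''bad'')
          (aval (Const 0) s := aval (Plus (Cell ''bad'' (Const 0)) (Minus (Const 1) (defect_exp k r))) s))) ''P'')
          [0..<k] = p"
        using s by (simp add: Inv_def ready_def)
    qed
  qed (simp_all add: Inv_def ready_def)
  show ?thesis unfolding check_com_def
    by (rule triple_conseq[OF triple_Seq[OF init loop]]) (simp_all add: Inv_def)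
qed

lemma decode_output_conv: "decode_output vs s = decode {i. i < n \<and> s ''S'' i \<noteq> 0}"
  by (auto simp: decode_output_def)

text \<open>All cells of \<open>S\<close> below \<open>n\<close> are rewritten, which erases the
  previous solution. The intersection appears because decoding ignores larger cells.\<close>

lemma triple_store:
  "triple n (\<lambda>s. ready s \<and> s ''I'' = f) (store_com r)
     (\<lambda>s. ready s \<and> s ''I'' = f \<and> s ''size'' 0 = r \<and>
        decode_output vs s = decode ({..<n} \<inter> set (map f [0..<r])))"
proof -
  define Inv where "Inv j s \<longleftrightarrow> ready s \<and> s ''I'' = f \<and>
     (\<forall>i<j. s ''S'' i \<noteq> 0 \<longleftrightarrow> i \<in> set (map f [0..<r]))" for j s
  have loop: "triple n (Inv 0)
    (For ''J'' 0 (Assign ''S'' (Cell ''J'' (Const 0)) (mem_exp r (Cell ''J'' (Const 0))))) (Inv n)"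
  proof (rule triple_For)
    fix j
    show "triple n (\<lambda>s. Inv j s \<and> s ''J'' 0 = j)
      (Assign ''S'' (Cell ''J'' (Const 0)) (mem_exp r (Cell ''J'' (Const 0))))
      (\<lambda>s. Inv (Suc j) s \<and> s ''J'' 0 = j)"
    proof (rule triple_Assign)
      fix s assume s: "Inv j s \<and> s ''J'' 0 = j"
      with aval_mem_exp[of r "Cell ''J'' (Const 0)" s]
      have "aval (mem_exp r (Cell ''J'' (Const 0))) s \<noteq> 0 \<longleftrightarrow> j \<in> set (map f [0..<r])"
        by (simp add: Inv_def del: set_map)
      with s show "Inv (Suc j) (s(''S'' := (s ''S'')
          (aval (Cell ''J'' (Const 0)) s := aval (mem_exp r (Cell ''J'' (Const 0))) s))) \<and>
        (s(''S'' := (s ''S'')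
          (aval (Cell ''J'' (Const 0)) s := aval (mem_exp r (Cell ''J'' (Const 0))) s))) ''J'' 0 = j"
        by (simp add: Inv_def ready_def less_Suc_eq del: set_map)
    qed
  qed (auto simp: Inv_def ready_def)
  have size: "triple n (Inv n) (Assign ''size'' (Const 0) (Const r)) (\<lambda>s. Inv n s \<and> s ''size'' 0 = r)"
    by (rule triple_Assign) (auto simp: Inv_def ready_def)
  have dec: "decode_output vs s = decode ({..<n} \<inter> set (map f [0..<r]))" if "Inv n s" for s
    unfolding decode_output_conv using that by (intro arg_cong[of _ _ decode]) (auto simp: Inv_def)
  show ?thesis unfolding store_com_def
    by (rule triple_conseq[OF triple_Seq[OF loop size]]) (auto simp: dec, auto simp: Inv_def)
qed

text \<open>
  Invariant of the search with initial solution \<open>B\<close>: \<open>D\<close> holds the tuples tried so far, all of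
  length at most \<open>m\<close>. The value of \<open>size\<close> is only an upper bound for the size of the current
  solution, because tuples may contain repetitions.
\<close>

definition search_inv :: "nat \<Rightarrow> 'v set \<Rightarrow> nat list set \<Rightarrow> store \<Rightarrow> bool" where
  "search_inv m B D s \<longleftrightarrow> ready s \<and>
     card (decode_output vs s) \<le> s ''size'' 0 \<and> s ''size'' 0 \<le> card B \<and>
     (decode_output vs s = B \<or> k_path_vertex_cover k G (decode_output vs s) \<and> s ''size'' 0 \<le> m) \<and>
     (\<forall>p\<in>D. k_path_vertex_cover k G (decode (set p)) \<longrightarrow> s ''size'' 0 \<le> length p)"

text \<open>The condition for the new tuple \<open>p\<close> is vacuous if the check fails, holds
  already if \<open>size\<close> is at most \<open>r\<close>, and is established by storing
  \<open>p\<close> otherwise.\<close>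

lemma triple_step:
  assumes p: "p \<in> tuples n r" and "r \<le> m"
  shows "triple n (\<lambda>s. search_inv m B D s \<and> map (s ''I'') [0..<r] = p) (step_com k r)
    (\<lambda>s. search_inv m B (insert p D) s \<and> map (s ''I'') [0..<r] = p)"
proof (rule tripleI)
  fix s0 assume s0: "search_inv m B D s0 \<and> map (s0 ''I'') [0..<r] = p"
  have len: "length p = r" and sub: "set p \<subseteq> {..<n}" using p by (auto simp: tuples_def)
  define M where "M s \<longleftrightarrow> search_inv m B D s \<and> s ''I'' = s0 ''I'' \<and>
     (s ''bad'' 0 = 0 \<longleftrightarrow> k_path_vertex_cover k G (decode (set p)))" for s
  define Q where "Q s \<longleftrightarrow> search_inv m B (insert p D) s \<and> s ''I'' = s0 ''I''" for s
  have check: "triple n (\<lambda>s. ready s \<and> s = s0) (check_com k r) M"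
  proof (rule triple_conseq[OF triple_check])
    fix s
    assume s: "(ready s \<and> s ''I'' = s0 ''I'' \<and> s ''S'' = s0 ''S'' \<and> s ''size'' = s0 ''size'') \<and>
        (s ''bad'' 0 \<noteq> 0 \<longleftrightarrow> (\<exists>p\<in>tuples n k. avoiding_path (set (map (s0 ''I'') [0..<r])) p))"
    then have "decode_output vs s = decode_output vs s0" by (simp add: decode_output_def)
    with s s0 have "search_inv m B D s" by (simp add: search_inv_def ready_def)
    moreover have "s ''bad'' 0 = 0 \<longleftrightarrow> \<not> (\<exists>q\<in>tuples n k. avoiding_path (set p) q)"
      using conjunct2[OF s] unfolding conjunct2[OF s0] by argo
    ultimately show "M s" using conjunct1[OF s] by (simp add: M_def cover_decode_iff[OF sub])
  qed auto
  have store: "triple n (\<lambda>s. (M s \<and> aval (Cell ''bad'' (Const 0)) s = 0) \<and>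
      aval (Minus (Cell ''size'' (Const 0)) (Const r)) s \<noteq> 0) (store_com r) Q"
  proof (rule tripleI)
    fix s1 assume s1: "(M s1 \<and> aval (Cell ''bad'' (Const 0)) s1 = 0) \<and>
      aval (Minus (Cell ''size'' (Const 0)) (Const r)) s1 \<noteq> 0"
    then have "ready s1 \<and> s1 ''I'' = s0 ''I''" by (simp add: M_def search_inv_def)
    with triple_store[of "s0 ''I''" r] obtain t s where ex: "exec (store_com r) s1 t s"
      "t \<le> poly (loop_poly (store_com r)) n"
      and s: "ready s \<and> s ''I'' = s0 ''I'' \<and> s ''size'' 0 = r \<and>
        decode_output vs s = decode ({..<n} \<inter> set (map (s0 ''I'') [0..<r]))"
      unfolding triple_def by blast
    have "{..<n} \<inter> set (map (s0 ''I'') [0..<r]) = set p" using s0 sub by auto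
    with s have dec: "decode_output vs s = decode (set p)" by simp
    have "card (decode (set p)) \<le> r"
      using card_image_le[of "set p" "(!) vs"] card_length[of p] len by simp
    \<comment> \<open>By the guard the new value \<open>r\<close> is below the old
      \<open>size\<close>, so the bounds by \<open>card B\<close> and by the tuples in
      \<open>D\<close> survive.\<close>
    with s1 s dec \<open>r \<le> m\<close> len have "Q s"
      by (fastforce simp: Q_def M_def search_inv_def)
    with ex show "\<exists>t s'. exec (store_com r) s1 t s' \<and> t \<le> poly (loop_poly (store_com r)) n \<and> Q s'"
      by blast
  qed
  have "triple n (\<lambda>s. ready s \<and> s = s0) (step_com k r) Q"
    unfolding step_com_def
    by (rule triple_Seq[OF check], rule triple_If[OF triple_Skip triple_If[OF store triple_Skip]])
      (auto simp: M_def Q_def search_inv_def len)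
  moreover have "ready s0 \<and> s0 = s0" using s0 by (simp add: search_inv_def)
  ultimately obtain t s where "exec (step_com k r) s0 t s" "t \<le> poly (loop_poly (step_com k r)) n" "Q s"
    unfolding triple_def by blast
  with s0 show "\<exists>t s. exec (step_com k r) s0 t s \<and> t \<le> poly (loop_poly (step_com k r)) n \<and>
      search_inv m B (insert p D) s \<and> map (s ''I'') [0..<r] = p"
    by (metis Q_def)
qed

lemma triple_search:
  assumes "l \<le> m"
  shows "triple n (search_inv m B {}) (search_com k l) (search_inv m B (\<Union>r\<le>l. tuples n r))"
proof -
  have level: "triple n (search_inv m B D) (nest ''I'' r (step_com k r)) (search_inv m B (D \<union> tuples n r))"
    if "r \<le> m" for r D
  proof (rule triple_nest)
    show "triple n (\<lambda>s. search_inv m B D s \<and> map (s ''I'') [0..<r] = p) (step_com k r)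
        (\<lambda>s. search_inv m B (insert p D) s \<and> map (s ''I'') [0..<r] = p)"
      if "p \<in> tuples n r" for D p
      using that \<open>r \<le> m\<close> by (rule triple_step)
  qed (auto simp: search_inv_def ready_def decode_output_def)
  show ?thesis using assms
  proof (induction l)
    case 0
    then show ?case using level[of 0 "{}"] by simp
  next
    case (Suc l)
    have "triple n (search_inv m B {}) (search_com k (Suc l))
        (search_inv m B ((\<Union>r\<le>l. tuples n r) \<union> tuples n (Suc l)))"
      unfolding search_com.simps using Suc by (intro triple_Seq[OF _ level]) auto
    then show ?case by (simp add: atMost_Suc Un_commute)
  qed
qed

text \<open>A cover \<open>T\<close> with at most \<open>m\<close> vertices has a repetition-free
  listing, which is a tuple of length exactly \<open>card T\<close> and was therefore tried. As
  \<open>size\<close> bounds the true cardinality from above, minimality carries over.\<close>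

lemma search_inv_imp_smaller_candidate:
  assumes "search_inv m B (\<Union>r\<le>m. tuples n r) s"
  shows "smaller_candidate k G (int m) B (decode_output vs s)"
proof -
  have "s ''size'' 0 \<le> card T" if T: "k_path_vertex_cover k G T" "card T \<le> m" for T
  proof -
    have sub: "T \<subseteq> verts G" using T by (simp add: k_path_vertex_cover_def)
    then have "finite T" using finite_set[of vs] by (simp add: set_vs finite_subset)
    then obtain ts where ts: "set ts = T" "distinct ts" using finite_distinct_list by blast
    have "set ts \<subseteq> (!) vs ` {..<n}"
      using sub ts by (simp add: verts_conv)
    then have "ts \<in> lists ((!) vs ` {..<n})" by auto
    then obtain p where p: "p \<in> lists {..<n}" "ts = map ((!) vs) p" by (auto simp: lists_image)
    have len: "length p = card T" using ts p distinct_card[of ts] by simp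
    then have "p \<in> (\<Union>r\<le>m. tuples n r)" using p(1) T(2) by (auto simp: tuples_def)
    moreover have "decode (set p) = T" using ts p by simp
    ultimately show ?thesis using assms T(1) len by (fastforce simp: search_inv_def)
  qed
  then show ?thesis
    using assms unfolding search_inv_def smaller_candidate_def by fastforce
qed

section \<open>The initial solution and its size\<close>

lemma card_decode:
  assumes "B \<subseteq> verts G"
  shows "card B = (\<Sum>i<n. if vs ! i \<in> B then 1 else 0)"
proof -
  have "inj_on ((!) vs) {i. i < n \<and> vs ! i \<in> B}"
    using inj_on_nth_vs by (rule inj_on_subset) auto
  from card_image[OF this] have "card B = card {i. i < n \<and> vs ! i \<in> B}"
    by (simp add: decode_Collect[OF assms])
  also have "\<dots> = (\<Sum>i<n. if vs ! i \<in> B then 1 else 0)"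
    by (simp add: sum.If_cases Int_def)
  finally show ?thesis .
qed

lemma triple_init:
  assumes "verts G_O \<subseteq> verts G" "OPT \<subseteq> verts G_O"
  shows "triple n (\<lambda>s. s = encode_input vs G_O G OPT) init_com
    (search_inv m (OPT \<union> (verts G - verts G_O)) {})"
proof -
  let ?B = "OPT \<union> (verts G - verts G_O)"
  \<comment> \<open>Since \<open>OPT\<close> lies in the old graph, it is disjoint from the
    complement of \<open>VO\<close>; hence the sum written to \<open>S\<close> is this 0/1
    vector.\<close>
  let ?b = "\<lambda>i. if vs ! i \<in> ?B then 1 else 0 :: nat"
  \<comment> \<open>\<open>R\<close> is known up to and including \<open>j\<close>: cell 0 is
    initially 0, and round \<open>j\<close> fills cell \<open>Suc j\<close>.\<close>
  define Inv where "Inv j s \<longleftrightarrow> s ''n'' 0 = n \<and> s ''EN'' = adjacency_matrix vs (edges G) \<and>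
     s ''VO'' = vertex_vector vs (verts G_O) \<and> s ''OPT'' = vertex_vector vs OPT \<and>
     (\<forall>i\<le>j. s ''R'' i = i * n) \<and> (\<forall>i<j. s ''S'' i = ?b i) \<and> s ''size'' 0 = (\<Sum>i<j. ?b i)" for j s
  have loop: "triple n (Inv 0) init_com (Inv n)"
    unfolding init_com_def
  proof (rule triple_For)
    fix j assume "j < n"
    then have "vs ! j \<in> verts G" by (simp flip: set_vs)
    with \<open>j < n\<close> have b: "vertex_vector vs OPT j + (1 - vertex_vector vs (verts G_O) j) = ?b j"
      using assms by (auto simp: vertex_vector_def)
    define M where "M s \<longleftrightarrow> s ''n'' 0 = n \<and> s ''EN'' = adjacency_matrix vs (edges G) \<and>
      s ''VO'' = vertex_vector vs (verts G_O) \<and> s ''OPT'' = vertex_vector vs OPT \<and>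
      (\<forall>i\<le>j. s ''R'' i = i * n) \<and> (\<forall>i<Suc j. s ''S'' i = ?b i) \<and> s ''J'' 0 = j" for s
    show "triple n (\<lambda>s. Inv j s \<and> s ''J'' 0 = j)
      (Seq (Assign ''S'' (Cell ''J'' (Const 0))
             (Plus (Cell ''OPT'' (Cell ''J'' (Const 0)))
                (Minus (Const 1) (Cell ''VO'' (Cell ''J'' (Const 0))))))
      (Seq (Assign ''size'' (Const 0)
             (Plus (Cell ''size'' (Const 0)) (Cell ''S'' (Cell ''J'' (Const 0)))))
          (Assign ''R'' (Plus (Cell ''J'' (Const 0)) (Const 1))
             (Plus (Cell ''R'' (Cell ''J'' (Const 0))) (Cell ''n'' (Const 0))))))
      (\<lambda>s. Inv (Suc j) s \<and> s ''J'' 0 = j)"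
    proof (intro triple_Seq)
      show "triple n (\<lambda>s. Inv j s \<and> s ''J'' 0 = j)
        (Assign ''S'' (Cell ''J'' (Const 0))
             (Plus (Cell ''OPT'' (Cell ''J'' (Const 0)))
                (Minus (Const 1) (Cell ''VO'' (Cell ''J'' (Const 0))))))
        (\<lambda>s. M s \<and> s ''size'' 0 = (\<Sum>i<j. ?b i))"
        by (rule triple_Assign) (use b in \<open>simp add: Inv_def M_def less_Suc_eq\<close>)
      show "triple n (\<lambda>s. M s \<and> s ''size'' 0 = (\<Sum>i<j. ?b i))
        (Assign ''size'' (Const 0)
             (Plus (Cell ''size'' (Const 0)) (Cell ''S'' (Cell ''J'' (Const 0)))))
        (\<lambda>s. M s \<and> s ''size'' 0 = (\<Sum>i<Suc j. ?b i))"
        by (rule triple_Assign) (simp add: M_def)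
      show "triple n (\<lambda>s. M s \<and> s ''size'' 0 = (\<Sum>i<Suc j. ?b i))
        (Assign ''R'' (Plus (Cell ''J'' (Const 0)) (Const 1))
             (Plus (Cell ''R'' (Cell ''J'' (Const 0))) (Cell ''n'' (Const 0))))
        (\<lambda>s. Inv (Suc j) s \<and> s ''J'' 0 = j)"
        by (rule triple_Assign) (simp add: M_def Inv_def le_Suc_eq)
    qed
  qed (auto simp: Inv_def)
  show ?thesis
  proof (rule triple_conseq[OF loop])
    fix s assume s: "Inv n s"
    have B: "?B \<subseteq> verts G" using assms by auto
    have "decode_output vs s = decode {i. i < n \<and> vs ! i \<in> ?B}"
      unfolding decode_output_conv using s
      by (intro arg_cong[of _ _ decode]) (auto simp: Inv_def split: if_splits)
    also have "\<dots> = ?B" by (rule decode_Collect[OF B])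
    finally have "decode_output vs s = ?B" .
    then show "search_inv m ?B {} s"
      using s card_decode[OF B] by (simp add: Inv_def search_inv_def ready_def)
  qed (simp add: Inv_def encode_input_def)
qed

theorem triple_reopt:
  assumes "verts G_O \<subseteq> verts G" "OPT \<subseteq> verts G_O"
  shows "triple n (\<lambda>s. s = encode_input vs G_O G OPT) (Seq init_com (search_com k m))
    (\<lambda>s. smaller_candidate k G (int m) (OPT \<union> (verts G - verts G_O)) (decode_output vs s))"
  by (rule triple_conseq[OF triple_Seq[OF triple_init[OF assms] triple_search[OF order_refl]]])
    (auto intro: search_inv_imp_smaller_candidate)

end

section \<open>Approximation ratio\<close>

text \<open>Every inserted or attached edge meets \<open>verts A\<close>, so a path avoiding
  \<open>verts A\<close> is already a path of \<open>G\<close> and is hit by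
  \<open>S\<close>.\<close>

lemma k_path_vertex_cover_insert_graph:
  assumes Ea: "Ea \<subseteq> verts G \<times> verts A" and simple: "simple_graph A"
    and S: "k_path_vertex_cover k G S"
  shows "k_path_vertex_cover k (insert_graph G A Ea) (S \<union> verts A)"
  unfolding k_path_vertex_cover_def
proof (intro conjI allI impI notI)
  show "S \<union> verts A \<subseteq> verts (insert_graph G A Ea)"
    using S by (auto simp: k_path_vertex_cover_def insert_graph_def)
next
  fix p assume p: "k_path k (insert_graph G A Ea) p" and disj: "set p \<inter> (S \<union> verts A) = {}"
  have "{p ! i, p ! Suc i} \<in> edges G" if "Suc i < k" for i
  proof -
    have "{p ! i, p ! Suc i} \<subseteq> set p" using p that by (auto simp: k_path_def)
    then have "{p ! i, p ! Suc i} \<inter> verts A = {}" using disj by auto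
    moreover have "{p ! i, p ! Suc i} \<in> edges (insert_graph G A Ea)"
      using p that by (simp add: k_path_def)
    moreover have "e \<in> edges G"
      if "e \<in> edges (insert_graph G A Ea)" "e \<inter> verts A = {}" for e
    proof -
      \<comment> \<open>An edge of \<open>A\<close> is a nonempty subset of \<open>verts A\<close>,
        so it cannot avoid that set.\<close>
      have "e \<notin> edges A"
      proof
        assume "e \<in> edges A"
        then have "e \<subseteq> verts A" "card e = 2" using simple by (auto simp: simple_graph_def)
        with that(2) show False by (auto simp: Int_absorb2)
      qed
      with that Ea show ?thesis by (auto simp: insert_graph_def)
    qed
    ultimately show ?thesis by blast
  qed
  then have "k_path k G p" using p disj by (auto simp: k_path_def insert_graph_def)
  then show False using S disj by (auto simp: k_path_vertex_cover_def)
qed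

text \<open>Paths of \<open>G\<close> survive the insertion and use only vertices of
  \<open>G\<close>. Hence the old optimum is no larger than the new one.\<close>

lemma k_path_vertex_cover_Int_verts:
  assumes "k_path_vertex_cover k (insert_graph G A Ea) S"
  shows "k_path_vertex_cover k G (S \<inter> verts G)"
  unfolding k_path_vertex_cover_def
proof (intro conjI allI impI)
  fix p assume p: "k_path k G p"
  then have "k_path k (insert_graph G A Ea) p" by (auto simp: k_path_def insert_graph_def)
  then have "set p \<inter> S \<noteq> {}" using assms by (simp add: k_path_vertex_cover_def)
  then show "set p \<inter> (S \<inter> verts G) \<noteq> {}" using p by (auto simp: k_path_def)
qed auto

lemma smaller_candidate_ratio:
  fixes \<epsilon> :: real
  assumes "\<epsilon> > 0" and S: "smaller_candidate k G \<lceil>real c / \<epsilon>\<rceil> B S"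
    and T: "k_path_vertex_cover k G T" and B: "card B \<le> card T + c"
  shows "real (card S) \<le> (1 + \<epsilon>) * real (card T)"
proof (cases "int (card T) \<le> \<lceil>real c / \<epsilon>\<rceil>")
  case True
  then have "real (card S) \<le> 1 * real (card T)" using S T by (simp add: smaller_candidate_def)
  also have "\<dots> \<le> (1 + \<epsilon>) * real (card T)" using \<open>\<epsilon> > 0\<close> by (intro mult_right_mono) auto
  finally show ?thesis .
next
  case False
  then have "real c / \<epsilon> \<le> real (card T)" by linarith
  then have "real c \<le> \<epsilon> * real (card T)" using \<open>\<epsilon> > 0\<close> by (simp add: field_simps)
  moreover have "card S \<le> card T + c" using S B by (simp add: smaller_candidate_def)
  ultimately show ?thesis by (simp add: algebra_simps)
qed

section \<open>The polynomial-time approximation scheme\<close>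

theorem theorem1:
  fixes k c :: nat
  assumes "k \<ge> 2" and "c \<ge> 1"
  shows "\<forall>\<epsilon>::real. \<epsilon> > 0 \<longrightarrow>
    (\<exists>(P :: com) (q :: nat poly).
      \<forall>(G_O :: 'v graph) G_A Ea OPT vs. reopt_instance k c G_O G_A Ea OPT vs \<longrightarrow>
        (let G_N = insert_graph G_O G_A Ea in
          \<exists>t s. exec P (encode_input vs G_O G_N OPT) t s \<and>
            t \<le> poly q (card (verts G_N)) \<and>
            (let S = decode_output vs s in
              k_path_vertex_cover k G_N S \<and>
              (\<forall>OPT_N. min_k_path_vertex_cover k G_N OPT_N \<longrightarrow>
                 real (card S) \<le> (1 + \<epsilon>) * real (card OPT_N)) \<and>
              smaller_candidate k G_N \<lceil>real c / \<epsilon>\<rceil> (OPT \<union> verts G_A) S)))"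
proof (intro allI impI)
  fix \<epsilon> :: real assume "\<epsilon> > 0"
  define m where "m = nat \<lceil>real c / \<epsilon>\<rceil>"
  have m: "int m = \<lceil>real c / \<epsilon>\<rceil>" using \<open>\<epsilon> > 0\<close> by (simp add: m_def less_le_trans[of "- 1" 0])
  \<comment> \<open>Program and polynomial are fixed by \<open>k\<close> and \<open>m\<close>, hence
    by \<open>k\<close>, \<open>c\<close> and \<open>\<epsilon>\<close>, before any instance is
    given.\<close>
  let ?P = "Seq init_com (search_com k m)"
  have "\<exists>t s. exec ?P (encode_input vs G_O (insert_graph G_O G_A Ea) OPT) t s \<and>
      t \<le> poly (loop_poly ?P) (card (verts (insert_graph G_O G_A Ea))) \<and>
      k_path_vertex_cover k (insert_graph G_O G_A Ea) (decode_output vs s) \<and>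
      (\<forall>OPT_N. min_k_path_vertex_cover k (insert_graph G_O G_A Ea) OPT_N \<longrightarrow>
         real (card (decode_output vs s)) \<le> (1 + \<epsilon>) * real (card OPT_N)) \<and>
      smaller_candidate k (insert_graph G_O G_A Ea) \<lceil>real c / \<epsilon>\<rceil> (OPT \<union> verts G_A)
        (decode_output vs s)"
    if inst: "reopt_instance k c G_O G_A Ea OPT vs"
    for G_O G_A :: "'v graph" and Ea OPT vs
  proof -
    let ?G = "insert_graph G_O G_A Ea"
    have simple: "simple_graph G_O" "simple_graph G_A" and disj: "verts G_O \<inter> verts G_A = {}"
      and c: "card (verts G_A) = c" and Ea: "Ea \<subseteq> verts G_O \<times> verts G_A"
      and OPT: "k_path_vertex_cover k G_O OPT"
      and OPT_le: "\<And>T. k_path_vertex_cover k G_O T \<Longrightarrow> card OPT \<le> card T"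
      and vs: "distinct vs" "set vs = verts ?G"
      using inst by (auto simp: reopt_instance_def min_k_path_vertex_cover_def)
    interpret enumerated_graph k ?G vs by unfold_locales (fact vs)+
    \<comment> \<open>The program only sees the complement of the old vertex set; disjointness
      identifies it with the inserted vertices.\<close>
    have VA: "verts ?G - verts G_O = verts G_A" using disj by (auto simp: insert_graph_def)
    have n: "length vs = card (verts ?G)" using vs distinct_card by metis
    have "verts G_O \<subseteq> verts ?G" "OPT \<subseteq> verts G_O"
      using OPT by (auto simp: insert_graph_def k_path_vertex_cover_def)
    from tripleE[OF triple_reopt[OF this, of m] refl] obtain t s where
      run: "exec ?P (encode_input vs G_O ?G OPT) t s" "t \<le> poly (loop_poly ?P) (card (verts ?G))"
      and cand: "smaller_candidate k ?G \<lceil>real c / \<epsilon>\<rceil> (OPT \<union> verts G_A) (decode_output vs s)"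
      unfolding VA m n .
    have "k_path_vertex_cover k ?G (OPT \<union> verts G_A)"
      using Ea simple(2) OPT by (rule k_path_vertex_cover_insert_graph)
    then have cover: "k_path_vertex_cover k ?G (decode_output vs s)"
      using cand by (auto simp: smaller_candidate_def)
    have ratio: "real (card (decode_output vs s)) \<le> (1 + \<epsilon>) * real (card T)"
      if T: "min_k_path_vertex_cover k ?G T" for T
    proof (rule smaller_candidate_ratio[OF \<open>\<epsilon> > 0\<close> cand])
      show cov: "k_path_vertex_cover k ?G T" using T by (simp add: min_k_path_vertex_cover_def)
      then have "finite T"
        using simple finite_subset[of T "verts ?G"]
        by (auto simp: k_path_vertex_cover_def simple_graph_def insert_graph_def)
      have "card (OPT \<union> verts G_A) \<le> card OPT + c" using card_Un_le[of OPT "verts G_A"] c by simp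
      also have "card OPT \<le> card (T \<inter> verts G_O)"
        by (rule OPT_le[OF k_path_vertex_cover_Int_verts[OF cov]])
      also have "\<dots> \<le> card T" using \<open>finite T\<close> by (intro card_mono) auto
      finally show "card (OPT \<union> verts G_A) \<le> card T + c" by simp
    qed
    from run cand cover ratio show ?thesis by blast
  qed
  then show "\<exists>(P :: com) (q :: nat poly).
      \<forall>(G_O :: 'v graph) G_A Ea OPT vs. reopt_instance k c G_O G_A Ea OPT vs \<longrightarrow>
        (let G_N = insert_graph G_O G_A Ea in
          \<exists>t s. exec P (encode_input vs G_O G_N OPT) t s \<and>
            t \<le> poly q (card (verts G_N)) \<and>
            (let S = decode_output vs s in
              k_path_vertex_cover k G_N S \<and>
              (\<forall>OPT_N. min_k_path_vertex_cover k G_N OPT_N \<longrightarrow>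
                 real (card S) \<le> (1 + \<epsilon>) * real (card OPT_N)) \<and>
              smaller_candidate k G_N \<lceil>real c / \<epsilon>\<rceil> (OPT \<union> verts G_A) S))"
    unfolding Let_def by blast
qed

end
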